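(* Let $\mathfrak{c}$ denote the cardinality of the continuum. For every free ultrafilter $p$ on $\mathbb{N}$, there exists a dense subgroup of $\mathbb{Z}_2^{\mathfrak{c}}$ which (with the subspace topology) is strongly $p$-pseudocompact and contains no non-trivial convergent sequences.
   Context: $\mathbb{Z}_2$ is the two-element group with the discrete topology, and powers of $\mathbb{Z}_2$ carry the product topology. For a free (non-principal) ultrafilter $p$ on $\mathbb{N}$, a point $x$ of a space $X$ is a $p$-limit of a sequence $\{x_n:n\in\mathbb{N}\}$ of points of $X$ if $\{n\in\mathbb{N}:x_n\in V\}\in p$ for every neighbourhood $V$ of $x$ in $X$. A space $X$ is strongly $p$-pseudocompact if for every sequence $\{U_n:n\in\mathbb{N}\}$ of non-empty open subsets of $X$ one can choose a point $x_n\in U_n$ for each $n\in\mathbb{N}$ in such a way that the sequence $\{x_n:n\in\mathbb{N}\}$ has a $p$-limit in $X$. A convergent sequence is non-trivial if it is not eventually constant. *)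

theory Defs
  imports "HOL-Analysis.Analysis" "HOL-Algebra.Product_Groups"
begin

text \<open>
  Ultrafilters on \<open>\<nat>\<close> are represented by the library type \<^typ>\<open>nat filter\<close>; a set \<open>A\<close> belongs
  to \<open>p\<close> iff \<open>eventually (\<lambda>n. n \<in> A) p\<close>.  Hence the \<open>p\<close>-limits of a sequence \<open>x\<close> in a space \<open>X\<close>
  are the points \<open>l\<close> with \<open>limitin X x l p\<close>.
\<close>

definition free_ultrafilter :: "nat filter \<Rightarrow> bool" where
  "free_ultrafilter p \<longleftrightarrow>
     p \<noteq> bot \<and>
     (\<forall>P. eventually P p \<or> eventually (\<lambda>n. \<not> P n) p) \<and>
     (\<forall>n. p \<noteq> principal {n})"

definition strongly_p_pseudocompact :: "nat filter \<Rightarrow> 'a topology \<Rightarrow> bool" where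
  "strongly_p_pseudocompact p X \<longleftrightarrow>
     (\<forall>U :: nat \<Rightarrow> 'a set. (\<forall>n. openin X (U n) \<and> U n \<noteq> {}) \<longrightarrow>
        (\<exists>x. (\<forall>n. x n \<in> U n) \<and> (\<exists>l. limitin X x l p)))"

definition nontrivial_convergent_sequence :: "'a topology \<Rightarrow> (nat \<Rightarrow> 'a) \<Rightarrow> bool" where
  "nontrivial_convergent_sequence X x \<longleftrightarrow>
     range x \<subseteq> topspace X \<and>
     (\<exists>l. limitin X x l sequentially) \<and>
     \<not> (\<exists>c. eventually (\<lambda>n. x n = c) sequentially)"

text \<open>
  The power \<open>\<int>\<^sub>2\<^sup>I\<close> as a group and as a space.  Both have the carrier
  \<open>\<Pi>\<^sub>E i\<in>I. {0..<2}\<close>, that is, functions that are \<open>undefined\<close> outside \<open>I\<close>.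
\<close>

definition Z2_power_group :: "'i set \<Rightarrow> ('i \<Rightarrow> int) monoid" where
  "Z2_power_group I = product_group I (\<lambda>_. integer_mod_group 2)"

definition Z2_power_topology :: "'i set \<Rightarrow> ('i \<Rightarrow> int) topology" where
  "Z2_power_topology I =
     product_topology (\<lambda>_. discrete_topology (carrier (integer_mod_group 2))) I"

end

theory Submission
  imports Defs
begin

text \<open>
  Let \<open>\<kappa>\<close> be the cardinality of the continuum.  There are only \<open>\<kappa>\<close> many
  sequences of basic open sets of \<open>\<int>\<^sub>2\<^sup>\<kappa>\<close>, so a group of size \<open>\<kappa>\<close> suffices.  Let \<open>G\<close> be the free Boolean group (finite sets under symmetric difference) on points
  \<open>(a, n)\<close> and \<open>(a, \<infinity>)\<close> for \<open>a < \<kappa>\<close>, where \<open>(a, n)\<close> is to land in the \<open>n\<close>-th set of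
  the \<open>a\<close>-th sequence and \<open>(a, \<infinity>)\<close> is to be the \<open>p\<close>-limit of \<open>(a, n)\<close>.  A character
  of \<open>G\<close> is determined by its values at the points \<open>(a, n)\<close>; the value at \<open>(a, \<infinity>)\<close> is the
  limit along \<open>p\<close>.  The group wanted is the image of \<open>G\<close> under \<open>\<kappa>\<close> many characters
  \<open>\<phi>\<^sub>\<beta>\<close>, where \<open>\<phi>\<^sub>\<beta>(a, n)\<close> is prescribed only if the coordinate \<open>\<beta>\<close> is restricted
  in the \<open>n\<close>-th set of the \<open>a\<close>-th sequence.  A sequence in \<open>G\<close> involves countably many
  \<open>a\<close>, which restrict countably many \<open>\<beta>\<close>; if every sequence in \<open>G\<close> is assigned to
  \<open>\<kappa>\<close> many \<open>\<beta>\<close>, then for one of them \<open>\<phi>\<^sub>\<beta>\<close> is free on the whole sequence and can be chosen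
  to be 1 infinitely often, unless the sequence is eventually trivial.
\<close>

section \<open>Parities of intersections with finite sets\<close>

lemma odd_card_sym_diff:
  assumes "finite A" "finite B"
  shows "odd (card (sym_diff A B)) \<longleftrightarrow> (odd (card A) \<noteq> odd (card B))"
proof -
  have "card A = card (A - B) + card (A \<inter> B)" "card B = card (B - A) + card (A \<inter> B)"
    using assms by (metis Diff_disjoint Int_Diff_Un Int_commute card_Un_disjoint finite_Diff finite_Int
        add.commute inf_assoc Int_Diff_disjoint)+
  moreover have "card (sym_diff A B) = card (A - B) + card (B - A)"
    using assms by (intro card_Un_disjoint) auto
  ultimately show ?thesis by presburger
qed

lemma odd_intersections_infinite:
  fixes f :: "nat \<Rightarrow> 'a set"
  assumes fin: "\<And>k. finite (f k)" and Z: "infinite Z" "Z \<subseteq> (\<Union>k. f k)"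
  shows "\<exists>D\<subseteq>Z. \<exists>\<^sub>\<infinity>k. odd (card (f k \<inter> D))"
proof -
  \<comment> \<open>Each step adds an index whose parity is fixed by one new point outside all earlier sets.\<close>
  define P where "P = (\<lambda>(D, J). finite D \<and> D \<subseteq> Z \<and> finite J \<and> (\<forall>j\<in>J. odd (card (f j \<inter> D))))"
  define R where "R = (\<lambda>(D, J) (D', J'). D \<subseteq> D' \<and> J \<subset> J' \<and> (\<forall>j\<in>J. f j \<inter> D' = f j \<inter> D))"
  have "\<exists>s. \<forall>n. P (s n) \<and> R (s n) (s (Suc n))"
  proof (rule dependent_nat_choice)
    show "\<exists>x. P x" by (rule exI[of _ "({}, {})"]) (simp add: P_def)
  next
    fix x :: "'a set \<times> nat set" and n :: nat
    assume Px: "P x"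
    obtain D J where x: "x = (D, J)" by fastforce
    have fD: "finite D" "D \<subseteq> Z" and fJ: "finite J" and odd: "\<And>j. j \<in> J \<Longrightarrow> odd (card (f j \<inter> D))"
      using Px by (auto simp: P_def x)
    have "finite (D \<union> (\<Union>j\<in>J. f j))" using fD fJ fin by auto
    then have "\<not> Z \<subseteq> D \<union> (\<Union>j\<in>J. f j)" using Z finite_subset by blast
    then obtain z where z: "z \<in> Z" "z \<notin> D" "\<And>j. j \<in> J \<Longrightarrow> z \<notin> f j" by blast
    then obtain k where k: "z \<in> f k" using Z by blast
    \<comment> \<open>The new point \<open>z\<close> flips the parity of \<open>f k\<close> and is
      added only if that parity is even. As \<open>z\<close> lies in \<open>f k\<close> but in no
      \<open>f j\<close> with \<open>j\<close> in \<open>J\<close>, the index \<open>k\<close> is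
      new and the old parities survive.\<close>
    define D' where "D' = (if odd (card (f k \<inter> D)) then D else insert z D)"
    have same: "f j \<inter> D' = f j \<inter> D" if "j \<in> J" for j using z that by (auto simp: D'_def)
    have "odd (card (f k \<inter> D'))" using z k fin[of k] by (simp add: D'_def)
    then have "P (D', insert k J)" using fD fJ z same odd by (auto simp: P_def D'_def)
    moreover have "R x (D', insert k J)" using z k same by (auto simp: R_def x D'_def)
    ultimately show "\<exists>y. P y \<and> R x y" by blast
  qed
  then obtain s where P: "\<And>n. P (s n)" and R: "\<And>n. R (s n) (s (Suc n))" by blast
  define D where "D n = fst (s n)" for n
  define J where "J n = snd (s n)" for n
  have inD: "D n \<subseteq> Z" "finite (J n)" "\<And>j. j \<in> J n \<Longrightarrow> odd (card (f j \<inter> D n))" for n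
    using P[of n] by (auto simp: P_def D_def J_def case_prod_beta)
  have step: "D n \<subseteq> D (Suc n)" "J n \<subset> J (Suc n)" "\<And>j. j \<in> J n \<Longrightarrow> f j \<inter> D (Suc n) = f j \<inter> D n" for n
    using R[of n] by (auto simp: R_def D_def J_def case_prod_beta)
  have monoD: "D m \<subseteq> D n" if "m \<le> n" for m n
    using lift_Suc_mono_le[of D] step(1) that by blast
  have monoJ: "J m \<subseteq> J n" if "m \<le> n" for m n
    using lift_Suc_mono_le[of J] step(2) that by blast
  have same: "f j \<inter> D n = f j \<inter> D m" if "j \<in> J m" "m \<le> n" for j m n
    using that(2) by (induction n rule: dec_induct) (use step(3) monoJ that(1) in blast)+
  have odd: "odd (card (f j \<inter> (\<Union>n. D n)))" if "j \<in> J m" for j m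
  proof -
    have "f j \<inter> (\<Union>n. D n) = f j \<inter> D m"
    proof (intro equalityI subsetI)
      fix x assume "x \<in> f j \<inter> (\<Union>n. D n)"
      then obtain n where "x \<in> f j" "x \<in> D n" by blast
      then have "x \<in> f j \<inter> D (max m n)" using monoD[of n "max m n"] by auto
      then show "x \<in> f j \<inter> D m" using same[OF that, of "max m n"] by simp
    qed auto
    then show ?thesis using inD(3) that by simp
  qed
  have "n \<le> card (J n)" for n
  proof (induction n)
    case (Suc n)
    then show ?case using psubset_card_mono[OF inD(2) step(2)[of n]] by simp
  qed simp
  then have "infinite (\<Union>n. J n)"
    by (meson UNIV_I UN_upper card_mono le_trans not_less_eq_eq)
  then have "infinite {k. odd (card (f k \<inter> (\<Union>n. D n)))}"
    by (rule contrapos_nn) (rule finite_subset, use odd in auto)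
  then show ?thesis using inD(1) by (intro exI[of _ "\<Union>n. D n"]) (auto simp: INFM_iff_infinite)
qed

text \<open>If the union is finite, the pigeonhole principle gives one point in infinitely many
  \<open>f k\<close>, and its singleton works; otherwise the union has an infinite small subset, to
  which the previous lemma applies. The abstract \<open>small\<close> allows both p-smallness and
  the trivial property.\<close>

lemma odd_intersections:
  fixes f :: "nat \<Rightarrow> 'a set"
  assumes fin: "\<And>k. finite (f k)" and ne: "\<exists>\<^sub>\<infinity>k. f k \<noteq> {}"
    and small_singleton: "\<And>z. small {z}"
    and small_infinite: "\<And>Y. infinite Y \<Longrightarrow> \<exists>Z\<subseteq>Y. infinite Z \<and> small Z"
    and small_subset: "\<And>Y Z. small Y \<Longrightarrow> Z \<subseteq> Y \<Longrightarrow> small Z"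
  shows "\<exists>D. small D \<and> (\<exists>\<^sub>\<infinity>k. odd (card (f k \<inter> D)))"
proof (cases "finite (\<Union>k. f k)")
  case True
  have "\<exists>\<^sub>\<infinity>k. \<exists>z\<in>(\<Union>k. f k). z \<in> f k" using ne by (rule INFM_mono) auto
  then obtain z where z: "\<exists>\<^sub>\<infinity>k. z \<in> f k"
    using INFM_finite_Bex_distrib[OF True, of "\<lambda>z k. z \<in> f k"] by blast
  have "\<exists>\<^sub>\<infinity>k. odd (card (f k \<inter> {z}))" using z by (rule INFM_mono) simp
  then show ?thesis using small_singleton by blast
next
  case False
  then obtain Z where Z: "Z \<subseteq> (\<Union>k. f k)" "infinite Z" "small Z" using small_infinite by blast
  then show ?thesis using odd_intersections_infinite[OF fin Z(2,1)] small_subset by blast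
qed

section \<open>Free ultrafilters and sets small along \<open>p\<close>\<close>

lemma free_ultrafilter_not_eventually:
  assumes "free_ultrafilter p"
  shows "eventually (\<lambda>n. \<not> P n) p \<longleftrightarrow> \<not> eventually P p"
  using assms eventually_conj[of P p "\<lambda>n. \<not> P n"]
  by (auto simp: free_ultrafilter_def eventually_False)

lemma free_ultrafilter_eventually_notin_finite:
  assumes p: "free_ultrafilter p" and "finite A"
  shows "eventually (\<lambda>n. n \<notin> A) p"
proof -
  have "eventually (\<lambda>n. n \<noteq> a) p" for a
  proof (rule ccontr)
    assume "\<not> ?thesis"
    then have ev: "eventually (\<lambda>n. n = a) p"
      using free_ultrafilter_not_eventually[OF p, of "\<lambda>n. n = a"] by simp
    have "eventually P p \<longleftrightarrow> P a" for P
    proof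
      assume "eventually P p"
      then have "eventually (\<lambda>n. P a) p" using ev by eventually_elim simp
      then show "P a" using p by (auto simp: free_ultrafilter_def eventually_False[symmetric])
    next
      assume "P a"
      then show "eventually P p" using ev by (auto elim: eventually_mono)
    qed
    then have "p = principal {a}" by (simp add: filter_eq_iff eventually_principal)
    then show False using p by (simp add: free_ultrafilter_def)
  qed
  then have "eventually (\<lambda>n. \<forall>a\<in>A. n \<noteq> a) p" using assms(2) by (simp add: eventually_ball_finite)
  then show ?thesis by (rule eventually_mono) auto
qed

lemma infinite_split:
  assumes "infinite (A :: nat set)"
  obtains B C where "B \<subseteq> A" "C \<subseteq> A" "infinite B" "infinite C" "B \<inter> C = {}"
proof -
  define e where "e = enumerate A"
  have inj: "inj e" using strict_mono_enumerate[OF assms] strict_mono_imp_inj_on by (auto simp: e_def)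
  have r: "range e \<subseteq> A" using enumerate_in_set[OF assms] by (auto simp: e_def)
  have "infinite (e ` (range ((*) 2)))" "infinite (e ` (range (\<lambda>n. Suc (2 * n))))"
    using inj by (auto simp: finite_image_iff[OF inj_on_subset[OF inj]] range_inj_infinite inj_def)
  moreover have "e ` (range ((*) 2)) \<inter> e ` (range (\<lambda>n. Suc (2 * n))) = {}"
    using inj by (auto simp: inj_eq) presburger
  moreover have "e ` range ((*) 2) \<subseteq> A" "e ` range (\<lambda>n. Suc (2 * n)) \<subseteq> A"
    using r by auto
  ultimately show thesis using that by metis
qed

text \<open>
  A character supported on a small set vanishes at all points \<open>(a, \<infinity>)\<close>, so these do not
  disturb parities computed on the points \<open>(a, n)\<close>.
\<close>

definition p_small :: "nat filter \<Rightarrow> ('a \<times> nat) set \<Rightarrow> bool" where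
  "p_small p D \<longleftrightarrow> (\<forall>a. eventually (\<lambda>n. (a, n) \<notin> D) p)"

text \<open>If a column of \<open>Y\<close> is infinite, split it into two disjoint infinite parts:
  at least one is not in \<open>p\<close>. If all columns are finite, \<open>Y\<close> itself is
  small because \<open>p\<close> is free.\<close>

lemma p_small_infinite:
  assumes p: "free_ultrafilter p" and Y: "infinite Y"
  shows "\<exists>Z\<subseteq>Y. infinite Z \<and> p_small p Z"
proof (cases "\<exists>a. infinite {n. (a, n) \<in> Y}")
  case True
  then obtain a where "infinite {n. (a, n) \<in> Y}" by blast
  then obtain B C where BC: "B \<subseteq> {n. (a, n) \<in> Y}" "C \<subseteq> {n. (a, n) \<in> Y}"
    "infinite B" "infinite C" "B \<inter> C = {}" by (rule infinite_split)
  obtain E where E: "E \<subseteq> {n. (a, n) \<in> Y}" "infinite E" "eventually (\<lambda>n. n \<notin> E) p"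
  proof (cases "eventually (\<lambda>n. n \<in> B) p")
    case True
    then have "eventually (\<lambda>n. n \<notin> C) p" by (rule eventually_mono) (use BC in auto)
    with BC show thesis by (intro that[of C])
  next
    case False
    then have "eventually (\<lambda>n. n \<notin> B) p"
      using free_ultrafilter_not_eventually[OF p] by blast
    with BC show thesis by (intro that[of B])
  qed
  have "p_small p (Pair a ` E)"
    unfolding p_small_def
  proof
    fix b show "eventually (\<lambda>n. (b, n) \<notin> Pair a ` E) p"
      using E(3) by (rule eventually_mono) auto
  qed
  moreover have "infinite (Pair a ` E)" using E by (simp add: finite_image_iff inj_on_def)
  ultimately show ?thesis using E by blast
next
  case False
  then have "p_small p Y"
    using free_ultrafilter_eventually_notin_finite[OF p, of "{n. (a, n) \<in> Y}" for a]
    by (simp add: p_small_def)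
  then show ?thesis using Y by blast
qed

lemma p_small_singleton:
  assumes "free_ultrafilter p"
  shows "p_small p {z}"
  unfolding p_small_def
proof
  fix a show "eventually (\<lambda>n. (a, n) \<notin> {z}) p"
    using free_ultrafilter_eventually_notin_finite[OF assms, of "{snd z}"]
    by (auto elim: eventually_mono)
qed

lemma p_small_subset: "p_small p Y \<Longrightarrow> Z \<subseteq> Y \<Longrightarrow> p_small p Z"
  unfolding p_small_def by (meson eventually_mono subsetD)

section \<open>Characters of the free Boolean group\<close>

text \<open>The point \<open>(a, \<infinity>)\<close> is encoded as \<open>(a, None)\<close>.\<close>

definition p_extension :: "nat filter \<Rightarrow> ('a \<times> nat) set \<Rightarrow> ('a \<times> nat option) set" where
  "p_extension p V = {(a, m). case m of Some n \<Rightarrow> (a, n) \<in> V | None \<Rightarrow> eventually (\<lambda>n. (a, n) \<in> V) p}"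

lemma p_extension_simps [simp]:
  "(a, Some n) \<in> p_extension p V \<longleftrightarrow> (a, n) \<in> V"
  "(a, None) \<in> p_extension p V \<longleftrightarrow> eventually (\<lambda>n. (a, n) \<in> V) p"
  by (auto simp: p_extension_def)

text \<open>Produces a character that is 1 infinitely often on a sequence of group elements. Either
  infinitely many \<open>S k\<close> contain points \<open>(a, Some n)\<close>, and a small set
  detects them without touching the limit points, or infinitely many are nonempty and consist of
  limit points only.\<close>

lemma p_extension_odd:
  fixes S :: "nat \<Rightarrow> ('a \<times> nat option) set"
  assumes p: "free_ultrafilter p" and fin: "\<And>k. finite (S k)" and ne: "\<exists>\<^sub>\<infinity>k. S k \<noteq> {}"
  shows "\<exists>V. \<exists>\<^sub>\<infinity>k. odd (card (S k \<inter> p_extension p V))"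
proof -
  define j where "j = (\<lambda>(a, n). (a :: 'a, Some (n :: nat)))"
  define f where "f k = j -` S k" for k
  \<comment> \<open>Made empty unless \<open>f k\<close> is, so that a nonempty \<open>e k\<close>
    is all of \<open>S k\<close> up to encoding.\<close>
  define e where "e k = {a. (a, None) \<in> S k \<and> f k = {}}" for k
  have "inj j" by (auto simp: j_def inj_def)
  then have finf: "finite (f k)" for k using fin finite_vimageI by (auto simp: f_def)
  have fine: "finite (e k)" for k
    by (rule finite_subset[OF _ finite_imageI[OF fin[of k], of fst]]) (force simp: e_def)
  have "\<exists>\<^sub>\<infinity>k. f k \<noteq> {} \<or> e k \<noteq> {}"
    using ne
  proof (rule INFM_mono)
    fix k assume "S k \<noteq> {}"
    then obtain a m where am: "(a, m) \<in> S k" by auto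
    show "f k \<noteq> {} \<or> e k \<noteq> {}"
    proof (cases m)
      case None
      then show ?thesis using am by (auto simp: e_def)
    next
      case (Some n)
      then have "(a, n) \<in> f k" using am by (simp add: f_def j_def)
      then show ?thesis by blast
    qed
  qed
  then consider "\<exists>\<^sub>\<infinity>k. f k \<noteq> {}" | "\<exists>\<^sub>\<infinity>k. e k \<noteq> {}" unfolding INFM_disj_distrib by blast
  then show ?thesis
  proof cases
    case 1
    obtain D where D: "p_small p D" "\<exists>\<^sub>\<infinity>k. odd (card (f k \<inter> D))"
    proof -
      have "\<exists>D. p_small p D \<and> (\<exists>\<^sub>\<infinity>k. odd (card (f k \<inter> D)))"
        using finf 1 p_small_singleton[OF p] p_small_infinite[OF p] p_small_subset
        by (rule odd_intersections)
      then show thesis using that by blast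
    qed
    have "S k \<inter> p_extension p D = j ` (f k \<inter> D)" for k
    proof -
      have none: "(a, None) \<notin> p_extension p D" for a
        using D(1) free_ultrafilter_not_eventually[OF p] by (simp add: p_small_def)
      have "(a, m) \<in> S k \<inter> p_extension p D \<longleftrightarrow> (a, m) \<in> j ` (f k \<inter> D)" for a m
        using none by (cases m) (force simp: f_def j_def image_iff)+
      then show ?thesis by auto
    qed
    then have "card (S k \<inter> p_extension p D) = card (f k \<inter> D)" for k
      using \<open>inj j\<close> by (simp add: card_image inj_on_subset)
    then show ?thesis using D(2) by (intro exI[of _ D]) simp
  next
    case 2
    obtain D where D: "\<exists>\<^sub>\<infinity>k. odd (card (e k \<inter> D))"
      using odd_intersections[of e "\<lambda>_. True", OF fine 2] by blast
    \<comment> \<open>Whole columns make the character constant along each column, so its value at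
      \<open>(a, None)\<close> can be prescribed freely.\<close>
    have "\<exists>\<^sub>\<infinity>k. odd (card (S k \<inter> p_extension p (D \<times> UNIV)))"
      using D
    proof (rule INFM_mono)
      fix k assume odd: "odd (card (e k \<inter> D))"
      then have "e k \<noteq> {}" by auto
      then have fk: "f k = {}" by (auto simp: e_def)
      have none: "(a, Some n) \<notin> S k" for a n
      proof -
        have "(a, n) \<notin> f k" using fk by simp
        then show ?thesis by (simp add: f_def j_def)
      qed
      have "(a, None) \<in> p_extension p (D \<times> UNIV) \<longleftrightarrow> a \<in> D" for a
        using p by (auto simp: free_ultrafilter_def)
      then have "(a, m) \<in> S k \<inter> p_extension p (D \<times> UNIV) \<longleftrightarrow> (a, m) \<in> (\<lambda>a. (a, None)) ` (e k \<inter> D)" for a m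
        using fk none by (cases m) (auto simp: e_def)
      then have "S k \<inter> p_extension p (D \<times> UNIV) = (\<lambda>a. (a, None)) ` (e k \<inter> D)" by auto
      then show "odd (card (S k \<inter> p_extension p (D \<times> UNIV)))"
        using odd by (simp add: card_image inj_on_def)
    qed
    then show ?thesis by blast
  qed
qed

section \<open>Sets of size at most the continuum as images of the reals\<close>

lemma surj_real_nat: "\<exists>h :: real \<Rightarrow> nat. surj h"
  by (rule exI[of _ "\<lambda>x. nat \<lfloor>x\<rfloor>"], rule surjI[of _ real]) simp

text \<open>Reals correspond to sets of naturals, and a pairing function packs a sequence of such
  sets into a single one.\<close>

lemma surj_real_sequences_real: "\<exists>h :: real \<Rightarrow> nat \<Rightarrow> real. surj h"
proof -
  obtain b :: "nat set \<Rightarrow> real" where b: "bij b"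
    using nat_sets_eqpoll_reals by (auto simp: eqpoll_def)
  define h where "h x n = b {m. prod_encode (n, m) \<in> inv_into UNIV b x}" for x n
  have "\<exists>x. h x = s" for s
  proof
    define A where "A = {k. case prod_decode k of (n, m) \<Rightarrow> m \<in> inv_into UNIV b (s n)}"
    show "h (b A) = s"
      using b by (auto simp: h_def A_def fun_eq_iff bij_is_inj bij_is_surj surj_f_inv_f)
  qed
  then show ?thesis by (metis surj_def)
qed

lemma surj_real_sequences:
  assumes "\<exists>g :: real \<Rightarrow> 'a. surj g"
  shows "\<exists>h :: real \<Rightarrow> nat \<Rightarrow> 'a. surj h"
proof -
  obtain g :: "real \<Rightarrow> 'a" where g: "surj g" using assms by blast
  obtain h :: "real \<Rightarrow> nat \<Rightarrow> real" where h: "surj h" using surj_real_sequences_real by blast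
  have "\<exists>x. (\<lambda>n. g (h x n)) = s" for s
  proof -
    obtain x where "h x = inv_into UNIV g \<circ> s" using h by (metis surjD)
    then have "(\<lambda>n. g (h x n)) = s" using g by (simp add: surj_f_inv_f)
    then show ?thesis ..
  qed
  then have "surj (\<lambda>x n. g (h x n))" unfolding surj_def by (blast intro: sym)
  then show ?thesis by blast
qed

lemma surj_real_prod:
  assumes "\<exists>g :: real \<Rightarrow> 'a. surj g" "\<exists>g :: real \<Rightarrow> 'b. surj g"
  shows "\<exists>h :: real \<Rightarrow> 'a \<times> 'b. surj h"
proof -
  obtain f :: "real \<Rightarrow> 'a" and g :: "real \<Rightarrow> 'b" where fg: "surj f" "surj g" using assms by blast
  obtain h :: "real \<Rightarrow> nat \<Rightarrow> real" where h: "surj h" using surj_real_sequences_real by blast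
  have "\<exists>x. (f (h x 0), g (h x 1)) = y" for y
  proof -
    obtain x where "h x = (\<lambda>n. if n = 0 then inv_into UNIV f (fst y) else inv_into UNIV g (snd y))"
      using h by (metis surjD)
    then have "(f (h x 0), g (h x 1)) = y" using fg by (simp add: surj_f_inv_f)
    then show ?thesis ..
  qed
  then have "surj (\<lambda>x. (f (h x 0), g (h x 1)))" unfolding surj_def by (blast intro: sym)
  then show ?thesis by blast
qed

text \<open>A list is coded by its length and any infinite sequence extending it.\<close>

lemma surj_real_list:
  assumes "\<exists>g :: real \<Rightarrow> 'a. surj g"
  shows "\<exists>h :: real \<Rightarrow> 'a list. surj h"
proof -
  obtain h :: "real \<Rightarrow> nat \<times> (nat \<Rightarrow> 'a)" where h: "surj h"
    using surj_real_prod[OF surj_real_nat surj_real_sequences[OF assms]] by blast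
  have "\<exists>x. map (snd (h x)) [0..<fst (h x)] = l" for l
  proof -
    obtain x where "h x = (length l, nth l)" using h by (metis surjD)
    then have "map (snd (h x)) [0..<fst (h x)] = l" by (simp add: map_nth)
    then show ?thesis ..
  qed
  then have "surj (\<lambda>x. map (snd (h x)) [0..<fst (h x)])" unfolding surj_def by (blast intro: sym)
  then show ?thesis by blast
qed

section \<open>Choice of continuum many characters\<close>

text \<open>
  The list \<open>L n\<close> stands for the basic open set of all \<open>x\<close> with \<open>x \<beta> = c\<close> for \<open>(\<beta>, c)\<close> in the
  list, and \<open>v \<beta>\<close> for the set of points where \<open>\<phi>\<^sub>\<beta>\<close> is 1.
\<close>

lemma exists_characters:
  assumes p: "free_ultrafilter p"
  shows "\<exists>v :: real \<Rightarrow> (real \<times> nat) set.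
    (\<forall>L :: nat \<Rightarrow> (real \<times> bool) list. \<exists>a. \<forall>n. \<forall>\<beta>\<in>fst ` set (L n).
        (a, n) \<in> v \<beta> \<longleftrightarrow> (\<beta>, True) \<in> set (L n)) \<and>
    (\<forall>S :: nat \<Rightarrow> (real \<times> nat option) set. (\<forall>k. finite (S k)) \<longrightarrow> (\<exists>\<^sub>\<infinity>k. S k \<noteq> {}) \<longrightarrow>
        (\<exists>\<beta>. \<exists>\<^sub>\<infinity>k. odd (card (S k \<inter> p_extension p (v \<beta>)))))"
proof -
  have real: "\<exists>g :: real \<Rightarrow> real. surj g" by (rule exI[of _ id]) simp
  have "\<exists>g :: real \<Rightarrow> bool. surj g"
    by (rule exI[of _ "\<lambda>x. x > 0"], rule surjI[of _ of_bool]) simp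
  then obtain U :: "real \<Rightarrow> nat \<Rightarrow> (real \<times> bool) list" where U: "surj U"
    using surj_real_sequences[OF surj_real_list[OF surj_real_prod[OF real]]] by blast
  have "\<exists>g :: real \<Rightarrow> nat option. surj g"
  proof -
    obtain h :: "real \<Rightarrow> nat" where h: "surj h" using surj_real_nat by blast
    have "surj (\<lambda>n. case n of 0 \<Rightarrow> None | Suc m \<Rightarrow> Some m)"
    proof (rule surjI)
      show "(case (case y of None \<Rightarrow> 0 | Some m \<Rightarrow> Suc m) of 0 \<Rightarrow> None | Suc m \<Rightarrow> Some m) = y" for y
        by (cases y) auto
    qed
    then show ?thesis using comp_surj[OF h] by blast
  qed
  \<comment> \<open>The extra real component makes every sequence appear at continuum many
    \<beta>.\<close>
  then obtain q :: "real \<Rightarrow> real \<times> (nat \<Rightarrow> (real \<times> nat option) list)" where q: "surj q"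
    using surj_real_prod[OF real surj_real_sequences[OF surj_real_list[OF surj_real_prod[OF real]]]] by blast
  have "\<forall>s :: nat \<Rightarrow> (real \<times> nat option) list. \<exists>V. (\<exists>\<^sub>\<infinity>k. set (s k) \<noteq> {}) \<longrightarrow>
      (\<exists>\<^sub>\<infinity>k. odd (card (set (s k) \<inter> p_extension p V)))"
    using p_extension_odd[OF p] by (metis List.finite_set)
  then obtain W :: "(nat \<Rightarrow> (real \<times> nat option) list) \<Rightarrow> (real \<times> nat) set" where
    W: "\<And>s. \<exists>\<^sub>\<infinity>k. set (s k) \<noteq> {} \<Longrightarrow> \<exists>\<^sub>\<infinity>k. odd (card (set (s k) \<inter> p_extension p (W s)))"
    by metis
  \<comment> \<open>Where the box \<open>U a n\<close> restricts \<beta>, the value is dictated by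
    the box; elsewhere it follows the set \<open>W\<close> chosen for the sequence assigned to
    \<beta>.\<close>
  define v where "v \<beta> = {(a, n). if \<beta> \<in> fst ` set (U a n) then (\<beta>, True) \<in> set (U a n)
    else (a, n) \<in> W (snd (q \<beta>))}" for \<beta>
  have "\<exists>a. \<forall>n. \<forall>\<beta>\<in>fst ` set (L n). (a, n) \<in> v \<beta> \<longleftrightarrow> (\<beta>, True) \<in> set (L n)"
    for L :: "nat \<Rightarrow> (real \<times> bool) list"
  proof -
    obtain a where "U a = L" using U by (metis surjD)
    then show ?thesis by (intro exI[of _ a]) (simp add: v_def)
  qed
  moreover have "\<exists>\<beta>. \<exists>\<^sub>\<infinity>k. odd (card (S k \<inter> p_extension p (v \<beta>)))"
    if S: "\<forall>k. finite (S k)" "\<exists>\<^sub>\<infinity>k. S k \<noteq> {}" for S :: "nat \<Rightarrow> (real \<times> nat option) set"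
  proof -
    have "\<forall>k. \<exists>l. set l = S k" using S(1) by (simp add: finite_list)
    then obtain s where s: "\<And>k. set (s k) = S k" by (auto dest!: choice)
    define C where "C = (\<Union>k. fst ` S k)"
    \<comment> \<open>The coordinates at which some column used by \<open>S\<close> has a prescribed
      value.\<close>
    define B where "B = (\<Union>a\<in>C. \<Union>n. fst ` set (U a n))"
    have "countable C" unfolding C_def using S(1)
      by (intro countable_UN countable_image) (auto intro: countable_finite)
    then have "countable B" unfolding B_def
      by (intro countable_UN countable_image) (auto intro: countable_finite)
    \<comment> \<open>A label \<open>r\<close> missed by \<open>B\<close> forces every \<beta> with
      \<open>q \<beta> = (r, s)\<close> outside \<open>B\<close>, so \<open>v \<beta>\<close> agrees
      with \<open>W s\<close> on all columns used by \<open>S\<close>, hence also at their limit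
      points.\<close>
    then have "(fst \<circ> q) ` B \<noteq> UNIV" 
      using uncountable_UNIV_real by (metis countable_image)
    then obtain r where r: "r \<notin> (fst \<circ> q) ` B" by blast
    obtain \<beta> where \<beta>: "q \<beta> = (r, s)" using q by (metis surjD)
    then have "\<beta> \<notin> B" using r by force
    then have v: "(a, n) \<in> v \<beta> \<longleftrightarrow> (a, n) \<in> W s" if "a \<in> C" for a n
      using that \<beta> by (auto simp: v_def B_def)
    have "(a, m) \<in> p_extension p (v \<beta>) \<longleftrightarrow> (a, m) \<in> p_extension p (W s)" if "(a, m) \<in> S k" for a m k
    proof -
      have "a \<in> C" using that by (force simp: C_def)
      then show ?thesis using v by (cases m) auto
    qed
    then have "S k \<inter> p_extension p (v \<beta>) = S k \<inter> p_extension p (W s)" for k by auto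
    then show ?thesis using W[of s] S(2) by (intro exI[of _ \<beta>]) (simp add: s)
  qed
  ultimately show ?thesis by (intro exI[of _ v] conjI allI impI) simp_all
qed

section \<open>The topology of the power of Z_2\<close>

lemma carrier_integer_mod_group_2: "carrier (integer_mod_group 2) = {0, 1}"
  by (auto simp: carrier_integer_mod_group)

lemma topspace_Z2_power: "topspace (Z2_power_topology I) = (\<Pi>\<^sub>E i\<in>I. {0, 1})"
  by (simp add: Z2_power_topology_def carrier_integer_mod_group_2)

lemma limitin_Z2_power:
  assumes "\<And>n. x n \<in> topspace (Z2_power_topology I)" "l \<in> topspace (Z2_power_topology I)"
  shows "limitin (Z2_power_topology I) x l F \<longleftrightarrow> (\<forall>i\<in>I. eventually (\<lambda>n. x n i = l i) F)"
proof -
  have "limitin (discrete_topology {0, 1}) (\<lambda>n. x n i) (l i) F \<longleftrightarrow> eventually (\<lambda>n. x n i = l i) F"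
    if "i \<in> I" for i
  proof
    assume "limitin (discrete_topology {0, 1}) (\<lambda>n. x n i) (l i) F"
    then have "eventually (\<lambda>n. x n i \<in> {l i}) F"
      unfolding limitin_def by (elim conjE allE[of _ "{l i}"]) auto
    then show "eventually (\<lambda>n. x n i = l i) F" by simp
  next
    assume "eventually (\<lambda>n. x n i = l i) F"
    moreover have "l i \<in> {0, 1}" using assms(2) that by (auto simp: topspace_Z2_power)
    ultimately show "limitin (discrete_topology {0, 1}) (\<lambda>n. x n i) (l i) F"
      by (auto simp: limitin_def elim: eventually_mono)
  qed
  then show ?thesis
    using assms unfolding topspace_Z2_power
    by (auto simp: Z2_power_topology_def limitin_componentwise carrier_integer_mod_group_2 PiE_def)
qed

text \<open>A basic box restricts finitely many coordinates, and with only the values 0 and 1 it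
  suffices to know where a coordinate is 1. The Boolean \<open>y\<close> matches the lists that
  prescribe the characters.\<close>

lemma openin_Z2_power_box:
  assumes "openin (Z2_power_topology I) W" "W \<noteq> {}"
  obtains F y where "finite F" "F \<subseteq> I"
    "\<And>x. x \<in> topspace (Z2_power_topology I) \<Longrightarrow> \<forall>i\<in>F. x i = 1 \<longleftrightarrow> y i \<Longrightarrow> x \<in> W"
proof -
  obtain y where y: "y \<in> W" using assms(2) by blast
  then obtain U where U: "finite {i \<in> I. U i \<noteq> {0, 1}}" "y \<in> Pi\<^sub>E I U" "Pi\<^sub>E I U \<subseteq> W"
    and Usub: "\<And>i. i \<in> I \<Longrightarrow> U i \<subseteq> {0, 1}"
    using assms(1) unfolding Z2_power_topology_def openin_product_topology_alt
    by (simp add: carrier_integer_mod_group_2) meson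
  show thesis
  proof (rule that[OF U(1), of "\<lambda>i. y i = 1"])
    fix x :: "'a \<Rightarrow> int"
    assume x: "x \<in> topspace (Z2_power_topology I)"
      and eq: "\<forall>i\<in>{i \<in> I. U i \<noteq> {0, 1}}. x i = 1 \<longleftrightarrow> y i = 1"
    have "x i \<in> U i" if i: "i \<in> I" for i
    proof (cases "U i = {0, 1}")
      case True
      then show ?thesis using x i by (auto simp: topspace_Z2_power)
    next
      case False
      have "x i \<in> {0, 1}" using x i by (auto simp: topspace_Z2_power)
      moreover have "y i \<in> U i" using U(2) i by auto
      moreover have "y i \<in> {0, 1}" using calculation Usub[OF i] by blast
      moreover have "x i = 1 \<longleftrightarrow> y i = 1" using eq i False by blast
      ultimately show ?thesis by auto
    qed
    then have "x \<in> Pi\<^sub>E I U" using x by (auto simp: topspace_Z2_power PiE_def)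
    then show "x \<in> W" using U(3) by blast
  qed auto
qed

section \<open>The dense subgroup\<close>

theorem corollary1p4:
  fixes p :: "nat filter" and I :: "'i set"
  assumes "free_ultrafilter p"
    and "I \<approx> (UNIV :: real set)"
  shows "\<exists>H. subgroup H (Z2_power_group I) \<and>
             Z2_power_topology I closure_of H = topspace (Z2_power_topology I) \<and>
             strongly_p_pseudocompact p (subtopology (Z2_power_topology I) H) \<and>
             \<not> (\<exists>x. nontrivial_convergent_sequence (subtopology (Z2_power_topology I) H) x)"
proof -
  obtain b :: "'i \<Rightarrow> real" where b: "bij_betw b I UNIV" using assms(2) by (auto simp: eqpoll_def)
  obtain v :: "real \<Rightarrow> (real \<times> nat) set" where
    v_box: "\<And>L :: nat \<Rightarrow> (real \<times> bool) list. \<exists>a. \<forall>n. \<forall>\<beta>\<in>fst ` set (L n).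
      (a, n) \<in> v \<beta> \<longleftrightarrow> (\<beta>, True) \<in> set (L n)" and
    v_odd: "\<And>S :: nat \<Rightarrow> (real \<times> nat option) set. \<forall>k. finite (S k) \<Longrightarrow> \<exists>\<^sub>\<infinity>k. S k \<noteq> {} \<Longrightarrow>
      \<exists>\<beta>. \<exists>\<^sub>\<infinity>k. odd (card (S k \<inter> p_extension p (v \<beta>)))"
    using exists_characters[OF assms(1)] by blast
  \<comment> \<open>Evaluates all characters at the group element \<open>g\<close>; the parity in
    coordinate \<open>i\<close> is the value of the character with index \<open>b i\<close>.\<close>
  define \<psi> :: "(real \<times> nat option) set \<Rightarrow> 'i \<Rightarrow> int"
    where "\<psi> g = (\<lambda>i\<in>I. of_bool (odd (card (g \<inter> p_extension p (v (b i))))))" for g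
  define H where "H = \<psi> ` {g. finite g}"
  have \<psi>_top: "\<psi> g \<in> topspace (Z2_power_topology I)" for g
    by (auto simp: \<psi>_def topspace_Z2_power)
  have HI: "\<psi> g \<in> H" if "finite g" for g using that by (simp add: H_def)
  have H_top: "H \<subseteq> topspace (Z2_power_topology I)" using \<psi>_top by (auto simp: H_def)
  have \<psi>_diff: "odd (card (sym_diff g h \<inter> p_extension p (v (b i)))) \<longleftrightarrow> \<psi> g i \<noteq> \<psi> h i"
    if "finite g" "finite h" "i \<in> I" for g h i
  proof -
    have "sym_diff g h \<inter> X = sym_diff (g \<inter> X) (h \<inter> X)" for X by blast
    then show ?thesis using that by (simp add: odd_card_sym_diff \<psi>_def)
  qed
  have \<psi>_mult: "\<psi> g \<otimes>\<^bsub>Z2_power_group I\<^esub> \<psi> h = \<psi> (sym_diff g h)" if "finite g" "finite h" for g h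
  proof -
    have "(\<psi> g i + \<psi> h i) mod 2 = \<psi> (sym_diff g h) i" if "i \<in> I" for i
      using \<psi>_diff[OF \<open>finite g\<close> \<open>finite h\<close> that] that by (auto simp: \<psi>_def)
    then show ?thesis by (auto simp: Z2_power_group_def \<psi>_def)
  qed
  have \<psi>_one: "\<one>\<^bsub>Z2_power_group I\<^esub> = \<psi> {}"
    by (auto simp: Z2_power_group_def \<psi>_def)
  have grp: "group (Z2_power_group I)" by (simp add: Z2_power_group_def)
  have H_carrier: "H \<subseteq> carrier (Z2_power_group I)"
    using H_top by (simp add: Z2_power_group_def topspace_Z2_power carrier_integer_mod_group_2)
  have sub: "subgroup H (Z2_power_group I)"
  proof (rule group.subgroupI[OF grp H_carrier])
    show "H \<noteq> {}" using HI[of "{}"] by auto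
  next
    fix x assume x: "x \<in> H"
    then obtain g where g: "finite g" "x = \<psi> g" by (auto simp: H_def)
    have "x \<otimes>\<^bsub>Z2_power_group I\<^esub> x = \<one>\<^bsub>Z2_power_group I\<^esub>"
      using g by (simp add: \<psi>_mult \<psi>_one)
    then have "inv\<^bsub>Z2_power_group I\<^esub> x = x"
      using group.inv_equality[OF grp] x H_carrier by blast
    then show "inv\<^bsub>Z2_power_group I\<^esub> x \<in> H" using x by simp
  next
    fix x y assume "x \<in> H" "y \<in> H"
    then show "x \<otimes>\<^bsub>Z2_power_group I\<^esub> y \<in> H" by (auto simp: H_def \<psi>_mult)
  qed
  \<comment> \<open>Serves twice: for density with a constant sequence, and for strong
    p-pseudocompactness.\<close>
  have box: "\<exists>a. \<forall>n. \<psi> {(a, Some n)} \<in> U n"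
    if U: "\<And>n. openin (Z2_power_topology I) (U n)" "\<And>n. U n \<noteq> {}" for U :: "nat \<Rightarrow> ('i \<Rightarrow> int) set"
  proof -
    have "\<exists>F y. finite F \<and> F \<subseteq> I \<and>
        (\<forall>x\<in>topspace (Z2_power_topology I). (\<forall>i\<in>F. x i = 1 \<longleftrightarrow> y i) \<longrightarrow> x \<in> U n)" for n
      by (rule openin_Z2_power_box[OF U]) blast
    then obtain F y where F: "\<And>n. finite (F n)" "\<And>n. F n \<subseteq> I" and
      y: "\<And>n x. x \<in> topspace (Z2_power_topology I) \<Longrightarrow> \<forall>i\<in>F n. x i = 1 \<longleftrightarrow> y n i \<Longrightarrow> x \<in> U n"
      by metis
    have "\<exists>l. set l = (\<lambda>i. (b i, y n i)) ` F n" for n using F(1) by (intro finite_list) simp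
    then obtain L where L: "\<And>n. set (L n) = (\<lambda>i. (b i, y n i)) ` F n" by metis
    obtain a where a: "\<And>n \<beta>. \<beta> \<in> fst ` set (L n) \<Longrightarrow> (a, n) \<in> v \<beta> \<longleftrightarrow> (\<beta>, True) \<in> set (L n)"
      using v_box by blast
    have "\<psi> {(a, Some n)} \<in> U n" for n
    proof (rule y[OF \<psi>_top], intro ballI)
      fix i assume i: "i \<in> F n"
      then have iI: "i \<in> I" using F(2) by blast
      \<comment> \<open>Injectivity of \<open>b\<close> on \<open>I\<close> ensures that no other
        coordinate contributes an entry for \<open>b i\<close>.\<close>
      have "(b i, True) \<in> set (L n) \<longleftrightarrow> y n i"
        using i iI F(2) b unfolding L by (auto simp: bij_betw_def dest: inj_onD)
      moreover have "b i \<in> fst ` set (L n)" using i by (force simp: L)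
      ultimately have "(a, n) \<in> v (b i) \<longleftrightarrow> y n i" using a by blast
      then show "\<psi> {(a, Some n)} i = 1 \<longleftrightarrow> y n i" using iI by (simp add: \<psi>_def Int_insert_left)
    qed
    then show ?thesis by blast
  qed
  have dense: "Z2_power_topology I closure_of H = topspace (Z2_power_topology I)"
    unfolding dense_intersects_open
  proof (intro allI impI, elim conjE)
    fix T assume "openin (Z2_power_topology I) T" "T \<noteq> {}"
    then obtain a where "\<psi> {(a, Some 0)} \<in> T" using box[of "\<lambda>_. T"] by blast
    then show "H \<inter> T \<noteq> {}" using HI by blast
  qed
  have pseudo: "strongly_p_pseudocompact p (subtopology (Z2_power_topology I) H)"
    unfolding strongly_p_pseudocompact_def
  proof (intro allI impI)
    fix U :: "nat \<Rightarrow> ('i \<Rightarrow> int) set"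
    assume U: "\<forall>n. openin (subtopology (Z2_power_topology I) H) (U n) \<and> U n \<noteq> {}"
    then have "\<forall>n. \<exists>W. openin (Z2_power_topology I) W \<and> U n = W \<inter> H"
      by (simp add: openin_subtopology)
    then obtain W where W: "\<And>n. openin (Z2_power_topology I) (W n)" "\<And>n. U n = W n \<inter> H" by metis
    then have "W n \<noteq> {}" for n using U by auto
    then obtain a where a: "\<And>n. \<psi> {(a, Some n)} \<in> W n" using box W(1) by blast
    \<comment> \<open>The limit point is the image of \<open>(a, None)\<close>, since each character
      takes there its limit along \<open>p\<close>.\<close>
    have "eventually (\<lambda>n. \<psi> {(a, Some n)} i = \<psi> {(a, None)} i) p" if "i \<in> I" for i
    proof (cases "eventually (\<lambda>n. (a, n) \<in> v (b i)) p")
      case True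
      then show ?thesis
        by (rule eventually_mono) (use True that in \<open>simp add: \<psi>_def Int_insert_left\<close>)
    next
      case False
      then have "eventually (\<lambda>n. (a, n) \<notin> v (b i)) p"
        using free_ultrafilter_not_eventually[OF assms(1)] by blast
      then show ?thesis
        by (rule eventually_mono) (use False that in \<open>simp add: \<psi>_def Int_insert_left\<close>)
    qed
    then have "limitin (subtopology (Z2_power_topology I) H) (\<lambda>n. \<psi> {(a, Some n)}) (\<psi> {(a, None)}) p"
      using HI \<psi>_top by (simp add: limitin_subtopology limitin_Z2_power)
    moreover have "\<psi> {(a, Some n)} \<in> U n" for n using a W(2) HI by simp
    ultimately show "\<exists>x. (\<forall>n. x n \<in> U n) \<and>
        (\<exists>l. limitin (subtopology (Z2_power_topology I) H) x l p)"
      by (intro exI[of _ "\<lambda>n. \<psi> {(a, Some n)}"]) blast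
  qed
  have "\<not> nontrivial_convergent_sequence (subtopology (Z2_power_topology I) H) x" for x
  proof
    assume "nontrivial_convergent_sequence (subtopology (Z2_power_topology I) H) x"
    then obtain l where x: "\<And>n. x n \<in> H"
      and lim: "limitin (subtopology (Z2_power_topology I) H) x l sequentially"
      and nc: "\<not> eventually (\<lambda>n. x n = l) sequentially"
      unfolding nontrivial_convergent_sequence_def by (auto simp: image_subset_iff)
    have "l \<in> H" using lim by (simp add: limitin_subtopology)
    then obtain h where h: "finite h" "l = \<psi> h" by (auto simp: H_def)
    obtain g where g: "\<And>n. finite (g n)" "\<And>n. x n = \<psi> (g n)" 
      using x unfolding H_def by (simp add: image_iff) metis
    have "\<exists>\<^sub>\<infinity>n. x n \<noteq> l" using nc by (simp add: cofinite_eq_sequentially frequently_def)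
    \<comment> \<open>Passing to differences with \<open>h\<close> reduces the limit to the
      identity; a coordinate with infinitely many odd parities then contradicts convergence.\<close>
    then have "\<exists>\<^sub>\<infinity>n. sym_diff (g n) h \<noteq> {}" by (rule INFM_mono) (use g h in auto)
    then obtain \<beta> where \<beta>: "\<exists>\<^sub>\<infinity>n. odd (card (sym_diff (g n) h \<inter> p_extension p (v \<beta>)))"
      using v_odd[of "\<lambda>n. sym_diff (g n) h"] g(1) h(1) by auto
    obtain i where i: "i \<in> I" "\<beta> = b i" using b by (metis UNIV_I bij_betw_def imageE)
    have "\<exists>\<^sub>\<infinity>n. x n i \<noteq> l i" using \<beta> \<psi>_diff[OF g(1) h(1) i(1)] by (simp add: i(2) g(2) h(2))
    moreover have "eventually (\<lambda>n. x n i = l i) sequentially"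
      using lim limitin_Z2_power[of x I l] x \<open>l \<in> H\<close> H_top i(1) by (auto simp: limitin_subtopology)
    ultimately show False by (simp add: cofinite_eq_sequentially frequently_def)
  qed
  then show ?thesis using sub dense pseudo by blast
qed

end
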